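(* Let $S=\{s_1,s_2\}$ be a set of two distinct nonempty binary strings. The Seeker wins the Renyi-Ulam game with lie restriction $r(S)$ if and only if at least one of the following holds: (a) $S$ contains one of the strings $0$, $1$, $01$, $10$ (equivalently, some element of $S$ is a substring of one of $0,1,01,10$); (b) $S$ is one of the following 28 sets: $\{000,101\}$, $\{000,1011\}$, $\{000,1101\}$; $\{010,111\}$, $\{010,0011\}$, $\{010,0111\}$, $\{010,1100\}$, $\{010,1110\}$, $\{010,00111\}$, $\{010,11100\}$; $\{101,0001\}$, $\{101,0011\}$, $\{101,1000\}$, $\{101,1100\}$, $\{101,00011\}$, $\{101,11000\}$; $\{111,0010\}$, $\{111,0100\}$; $\{0001,1011\}$, $\{0001,1101\}$, $\{0010,0111\}$, $\{0010,1110\}$, $\{0011,0101\}$, $\{0100,0111\}$, $\{0100,1110\}$, $\{1000,1011\}$, $\{1000,1101\}$, $\{1010,1100\}$; (c) $S=\{s_1,s_2\}$ with $s_1\in\{00,001,100\}$ and $s_2\in R_\#$, or with $s_1\in\{11,011,110\}$ and $s_2\in R_\#^{inv}$.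
   Context: For a set $S$ of nonempty binary strings, $r(S)$ is the set of all finite binary strings that contain no element of $S$ as a contiguous substring. Renyi-Ulam game with lie restriction $R$ (a set of binary strings): the Obscurer picks $x\in\{1,\dots,n\}$; on each turn the Seeker asks whether $x$ lies in a chosen subset of $\{1,\dots,n\}$ and the Obscurer answers yes or no. For a candidate $y\in\{1,\dots,n\}$, its lie pattern is the binary string whose $i$-th bit is $1$ if the $i$-th answer is false for $y$ and $0$ if it is true. The Obscurer's answers must be such that the lie pattern of her number lies in $R$ after every answer. The Seeker wins for $n$ if he has an adaptive strategy which, after finitely many questions, guarantees that at most one $y\in\{1,\dots,n\}$ has its lie pattern in $R$. "The Seeker wins" (for $R$) means he wins for every $n\ge1$; otherwise the Obscurer wins. $R_\#$ is the set of binary strings containing no substring of the form $01^k0$ with $k=0$ or $k\ge2$; explicitly $R_\#=\{1^a w 1^c: a,c\ge0,\ w \text{ empty or } w=(01)^j0 \text{ for some } j\ge0\}$. $R_\#^{inv}$ is obtained from $R_\#$ by swapping $0$ and $1$ in every string. *)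

theory Defs
  imports "HOL-Library.Sublist" "HOL-Library.Z2"
begin

definition avoiding :: "bit list set \<Rightarrow> bit list set" where
  "avoiding S = {w. \<not> (\<exists>s\<in>S. sublist s w)}"

definition R_sharp :: "bit list set" where
  "R_sharp = avoiding {0 # replicate k 1 @ [0] | k. k = 0 \<or> k \<ge> 2}"

definition R_sharp_inv :: "bit list set" where
  "R_sharp_inv = map (\<lambda>b. 1 - b) ` R_sharp"

text \<open>
  A Seeker strategy maps the answers received so far (oldest first, \<open>True\<close> is yes) to the set he
  asks about next. Thus \<open>q (take i as)\<close> is the question to which \<open>as ! i\<close> is the answer, and
  bit \<open>i\<close> of the lie pattern is \<open>1\<close> iff that answer is false for \<open>y\<close>.
\<close>

definition lie_pattern :: "(bool list \<Rightarrow> nat set) \<Rightarrow> bool list \<Rightarrow> nat \<Rightarrow> bit list" where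
  "lie_pattern q as y =
    map (\<lambda>i. if as ! i \<longleftrightarrow> y \<in> q (take i as) then 0 else 1) [0..<length as]"

definition legal_answers ::
  "bit list set \<Rightarrow> nat \<Rightarrow> (bool list \<Rightarrow> nat set) \<Rightarrow> bool list \<Rightarrow> bool" where
  "legal_answers R n q as \<longleftrightarrow>
    (\<exists>x\<in>{1..n}. \<forall>k\<in>{1..length as}. lie_pattern q (take k as) x \<in> R)"

definition seeker_wins_for :: "bit list set \<Rightarrow> nat \<Rightarrow> bool" where
  "seeker_wins_for R n \<longleftrightarrow>
    (\<exists>q. (\<forall>h. q h \<subseteq> {1..n}) \<and>
      (\<exists>m. \<forall>as. length as = m \<longrightarrow> legal_answers R n q as \<longrightarrow>
        card {y \<in> {1..n}. lie_pattern q as y \<in> R} \<le> 1))"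

definition seeker_wins :: "bit list set \<Rightarrow> bool" where
  "seeker_wins R \<longleftrightarrow> (\<forall>n\<ge>1. seeker_wins_for R n)"

end

theory Submission
  imports Defs
begin

text \<open>
  Two candidates decide everything: a Seeker who beats two candidates splits \<open>n\<close> candidates into
  two groups, plays until one group is eliminated and starts afresh, since a word that avoids \<open>S\<close>
  keeps doing so when its past is forgotten. For two candidates a question only chooses whether the
  two lie patterns receive equal or different bits, and the answer chooses which ones.

  For the sporadic pairs a fixed sequence of such choices works. If \<open>00\<close> leads to a loss, then a
  pattern ending in \<open>0\<close> can only continue with \<open>1\<close>, so the Seeker can force
  \<open>1\<^sup>a(01)\<^sup>j01\<^sup>a\<close>, which contains any given element of \<open>R_sharp\<close>.

  The Obscurer beats nine explicit pairs by staying inside a finite set of positions, and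
  \<open>{00, 01\<^sup>k0}\<close> for \<open>k \<ge> 2\<close> by keeping the lengths of the two final runs of ones from
  differing by \<open>0\<close> or \<open>k\<close>. Up to complementation, every pair outside the list contains,
  factor by factor, a pair that the Obscurer beats.
\<close>

section \<open>Reduction to two candidates\<close>

lemma avoiding_sublist: "w \<in> avoiding S \<Longrightarrow> sublist u w \<Longrightarrow> u \<in> avoiding S"
  unfolding avoiding_def using sublist_order.order_trans by blast

lemma lie_pattern_Nil [simp]: "lie_pattern q [] y = []"
  by (simp add: lie_pattern_def)

lemma lie_pattern_Cons:
  "lie_pattern q (a # as) y =
    (if a \<longleftrightarrow> y \<in> q [] then 0 else 1) # lie_pattern (\<lambda>h. q (a # h)) as y"
  by (simp add: lie_pattern_def upt_conv_Cons map_Suc_upt[symmetric] del: upt_Suc)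

lemma lie_pattern_snoc:
  "lie_pattern q (as @ [a]) y = lie_pattern q as y @ [if a \<longleftrightarrow> y \<in> q as then 0 else 1]"
  by (simp add: lie_pattern_def nth_append)

lemma prefix_lie_pattern: "prefix (lie_pattern q (take k as) y) (lie_pattern q as y)"
proof -
  have "prefix (lie_pattern q as y) (lie_pattern q (as @ bs) y)" for as bs
    by (induction bs rule: rev_induct) (auto simp: lie_pattern_snoc simp flip: append_assoc)
  from this[of "take k as" "drop k as"] show ?thesis by simp
qed

text \<open>
  In \<open>ask\<close>, the Seeker chooses whether the next bits are equal (\<open>e = 0\<close>) or different
  (\<open>e = 1\<close>), and the Obscurer chooses \<open>b\<close>.
\<close>

inductive wins :: "bit list set \<Rightarrow> bit list \<Rightarrow> bit list \<Rightarrow> bool" for R where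
  dead: "w \<notin> R \<or> w' \<notin> R \<Longrightarrow> wins R w w'"
| ask: "(\<And>b. wins R (w @ [b]) (w' @ [b + e])) \<Longrightarrow> wins R w w'"

lemma wins_mono: "wins R w w' \<Longrightarrow> R' \<subseteq> R \<Longrightarrow> wins R' w w'"
  by (induction rule: wins.induct) (blast intro: wins.intros)+

lemma wins_sym: "wins R w w' \<Longrightarrow> wins R w' w"
proof (induction rule: wins.induct)
  case (dead w w')
  then show ?case by (blast intro: wins.dead)
next
  case (ask w w' e)
  show ?case
  proof (rule wins.ask)
    fix b show "wins R (w' @ [b]) (w @ [b + e])"
      using ask.IH[of "b + e"] by (cases b; cases e) simp_all
  qed
qed

text \<open>A question affects two candidates only through the parity \<open>e\<close>, so negating
  \<open>ask\<close> yields at each turn an answer that keeps the position unwon.\<close>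

lemma not_wins_answers:
  assumes "\<not> wins R [] []"
  shows "\<exists>as. length as = m \<and> \<not> wins R (lie_pattern q as x) (lie_pattern q as y)"
proof (induction m)
  case 0
  then show ?case using assms by simp
next
  case (Suc m)
  then obtain as where as: "length as = m" "\<not> wins R (lie_pattern q as x) (lie_pattern q as y)"
    by blast
  define e :: bit where "e = (if x \<in> q as \<longleftrightarrow> y \<in> q as then 0 else 1)"
  obtain b where b: "\<not> wins R (lie_pattern q as x @ [b]) (lie_pattern q as y @ [b + e])"
    using as wins.ask by blast
  \<comment> \<open>The answer that is true for \<open>x\<close> exactly if \<open>b = 0\<close>, so
    \<open>x\<close> receives the bit \<open>b\<close>.\<close>
  define a where "a \<longleftrightarrow> (b = 0 \<longleftrightarrow> x \<in> q as)"
  have "lie_pattern q (as @ [a]) x = lie_pattern q as x @ [b]"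
    "lie_pattern q (as @ [a]) y = lie_pattern q as y @ [b + e]"
    by (auto simp: lie_pattern_snoc a_def e_def)
  with b as show ?case by (intro exI[of _ "as @ [a]"]) simp
qed

lemma wins_if_seeker_wins:
  assumes "seeker_wins (avoiding S)"
  shows "wins (avoiding S) [] []"
proof (rule ccontr)
  assume nw: "\<not> wins (avoiding S) [] []"
  obtain q m where m: "\<And>as. length as = m \<Longrightarrow> legal_answers (avoiding S) 2 q as \<Longrightarrow>
      card {y \<in> {1..2}. lie_pattern q as y \<in> avoiding S} \<le> 1"
    using assms[unfolded seeker_wins_def seeker_wins_for_def, rule_format, of 2] by auto
  obtain as where as: "length as = m"
    "\<not> wins (avoiding S) (lie_pattern q as 1) (lie_pattern q as 2)"
    using not_wins_answers[OF nw] by blast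
  then have alive: "lie_pattern q as 1 \<in> avoiding S" "lie_pattern q as 2 \<in> avoiding S"
    using wins.dead by blast+
  have "legal_answers (avoiding S) 2 q as"
    unfolding legal_answers_def
    using avoiding_sublist[OF alive(1) prefix_imp_sublist[OF prefix_lie_pattern]]
    by (intro bexI[of _ 1] ballI) simp_all
  moreover have "{y \<in> {1..2}. lie_pattern q as y \<in> avoiding S} = {1, 2}"
    using alive by (auto simp: le_Suc_eq numeral_2_eq_2)
  ultimately show False using m[OF as(1)] by simp
qed

section \<open>From two candidates to \<open>n\<close> candidates\<close>

definition survivors :: "bit list set \<Rightarrow> nat \<Rightarrow> (nat \<Rightarrow> bit list) \<Rightarrow> nat set" where
  "survivors R n f = {y \<in> {1..n}. f y \<in> R}"

text \<open>
  The bound \<open>m \<le> length as\<close> instead of equality lets the strategies for the two answers to a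
  question be combined even if they need different numbers of questions.
\<close>

definition strategy_from :: "bit list set \<Rightarrow> nat \<Rightarrow> (nat \<Rightarrow> bit list) \<Rightarrow> bool" where
  "strategy_from R n f \<longleftrightarrow>
    (\<exists>q m. (\<forall>h. q h \<subseteq> {1..n}) \<and>
      (\<forall>as. m \<le> length as \<longrightarrow> card (survivors R n (\<lambda>y. f y @ lie_pattern q as y)) \<le> 1))"

lemma survivors_append: "survivors (avoiding S) n (\<lambda>y. f y @ g y) \<subseteq> survivors (avoiding S) n f"
  unfolding survivors_def by (auto elim: avoiding_sublist)

lemma strategy_from_done:
  assumes "card (survivors (avoiding S) n f) \<le> 1"
  shows "strategy_from (avoiding S) n f"
proof -
  have "finite (survivors (avoiding S) n f)"
    by (simp add: survivors_def)
  then have "card (survivors (avoiding S) n (\<lambda>y. f y @ g y)) \<le> 1" for g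
    by (rule order.trans[OF card_mono[OF _ survivors_append] assms])
  then show ?thesis
    unfolding strategy_from_def by (intro exI[of _ "\<lambda>_. {}"] exI[of _ 0]) auto
qed

lemma strategy_from_ask:
  assumes "Q \<subseteq> {1..n}"
    and "\<And>a. strategy_from R n (\<lambda>y. f y @ [if a \<longleftrightarrow> y \<in> Q then 0 else 1])"
  shows "strategy_from R n f"
proof -
  have "\<forall>a. \<exists>q m. (\<forall>h. q h \<subseteq> {1..n}) \<and> (\<forall>as. m \<le> length as \<longrightarrow> card (survivors R n
      (\<lambda>y. (f y @ [if a \<longleftrightarrow> y \<in> Q then 0 else 1]) @ lie_pattern q as y)) \<le> 1)"
    using assms(2) unfolding strategy_from_def by blast
  then obtain q m where qm: "\<And>a h. q a h \<subseteq> {1..n}"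
    "\<And>a as. m a \<le> length as \<Longrightarrow> card (survivors R n
      (\<lambda>y. (f y @ [if a \<longleftrightarrow> y \<in> Q then 0 else 1]) @ lie_pattern (q a) as y)) \<le> 1"
    unfolding choice_iff by blast
  define q' where "q' h = (case h of [] \<Rightarrow> Q | a # h' \<Rightarrow> q a h')" for h
  have "\<forall>h. q' h \<subseteq> {1..n}"
    using assms(1) qm(1) by (auto simp: q'_def split: list.split)
  moreover have "card (survivors R n (\<lambda>y. f y @ lie_pattern q' as y)) \<le> 1"
    if len: "Suc (max (m True) (m False)) \<le> length as" for as
  proof -
    obtain a as' where as: "as = a # as'" using len by (cases as) auto
    have "m a \<le> length as'" using len as by (cases a) auto
    moreover have "(\<lambda>y. f y @ lie_pattern q' as y) =
        (\<lambda>y. (f y @ [if a \<longleftrightarrow> y \<in> Q then 0 else 1]) @ lie_pattern (q a) as' y)"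
      by (simp add: fun_eq_iff as lie_pattern_Cons q'_def)
    ultimately show ?thesis using qm(2) by presburger
  qed
  ultimately show ?thesis unfolding strategy_from_def by blast
qed

text \<open>Each group acts as one candidate because its members receive the same bits. Only a
  suffix of each pattern is tracked: once it is forbidden, the whole group is out, whatever came
  before.\<close>

lemma strategy_from_two_groups:
  assumes "wins (avoiding S) w w'"
    and "\<And>y. y \<in> A \<Longrightarrow> suffix w (f y)" "\<And>y. y \<in> B \<Longrightarrow> suffix w' (f y)"
    and "A \<subseteq> {1..n}" "B \<subseteq> {1..n}" "A \<inter> B = {}"
    and "survivors (avoiding S) n f \<subseteq> A \<union> B"
    and one: "\<And>g. survivors (avoiding S) n g \<subseteq> A \<or> survivors (avoiding S) n g \<subseteq> B
      \<Longrightarrow> strategy_from (avoiding S) n g"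
  shows "strategy_from (avoiding S) n f"
  using assms(1-3,7)
proof (induction arbitrary: f rule: wins.induct)
  case (dead w w')
  show ?case
  proof (rule one)
    have "y \<notin> survivors (avoiding S) n f" if "suffix u (f y)" "u \<notin> avoiding S" for u y
      using that avoiding_sublist suffix_imp_sublist by (fastforce simp: survivors_def)
    with dead show "survivors (avoiding S) n f \<subseteq> A \<or> survivors (avoiding S) n f \<subseteq> B"
      by blast
  qed
next
  case (ask w w' e)
  \<comment> \<open>Asking about both groups gives them equal bits, asking about one gives different
    bits; all other candidates are already eliminated.\<close>
  define Q where "Q = (if e = 0 then A \<union> B else A)"
  show ?case
  proof (rule strategy_from_ask)
    show "Q \<subseteq> {1..n}" using assms(4,5) by (auto simp: Q_def)
    fix a
    define b :: bit where "b = (if a then 0 else 1)"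
    show "strategy_from (avoiding S) n (\<lambda>y. f y @ [if a \<longleftrightarrow> y \<in> Q then 0 else 1])"
    proof (rule ask.IH[of b])
      fix y assume "y \<in> A"
      then show "suffix (w @ [b]) (f y @ [if a \<longleftrightarrow> y \<in> Q then 0 else 1])"
        using ask.prems(1) by (auto simp: Q_def b_def)
    next
      fix y assume "y \<in> B"
      then show "suffix (w' @ [b + e]) (f y @ [if a \<longleftrightarrow> y \<in> Q then 0 else 1])"
        using ask.prems(2) assms(6) by (auto simp: Q_def b_def)
    next
      show "survivors (avoiding S) n (\<lambda>y. f y @ [if a \<longleftrightarrow> y \<in> Q then 0 else 1]) \<subseteq> A \<union> B"
        by (rule order.trans[OF survivors_append ask.prems(3)])
    qed
  qed
qed

text \<open>Set one candidate against the rest; whichever group dies, fewer remain. The game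
  restarts from empty words, which are suffixes of every pattern.\<close>

lemma strategy_from_group:
  assumes "wins (avoiding S) [] []" "A \<subseteq> {1..n}" "survivors (avoiding S) n f \<subseteq> A"
  shows "strategy_from (avoiding S) n f"
  using assms(2,3)
proof (induction "card A" arbitrary: A f rule: less_induct)
  case less
  have fin: "finite A" using less.prems(1) finite_subset by blast
  show ?case
  proof (cases "card A \<le> 1")
    case True
    then show ?thesis
      using card_mono[OF fin less.prems(2)] by (intro strategy_from_done) simp
  next
    case False
    then obtain x where x: "x \<in> A" by fastforce
    show ?thesis
    proof (rule strategy_from_two_groups[OF assms(1), of "{x}" f "A - {x}"])
      fix g assume "survivors (avoiding S) n g \<subseteq> {x} \<or> survivors (avoiding S) n g \<subseteq> A - {x}"
      moreover have "card {x} < card A" "card (A - {x}) < card A"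
        using False x fin by (auto simp: card_Diff1_less simp del: card_Diff_insert)
      ultimately show "strategy_from (avoiding S) n g"
        using less.hyps[of "{x}" g] less.hyps[of "A - {x}" g] x less.prems(1) by blast
    qed (use x less.prems in auto)
  qed
qed

theorem seeker_wins_iff_wins: "seeker_wins (avoiding S) \<longleftrightarrow> wins (avoiding S) [] []"
proof
  assume "wins (avoiding S) [] []"
  then have "strategy_from (avoiding S) n (\<lambda>_. [])" for n
    by (rule strategy_from_group[of _ "{1..n}"]) (auto simp: survivors_def)
  then have "seeker_wins_for (avoiding S) n" for n
  proof -
    obtain q m where q: "\<forall>h. q h \<subseteq> {1..n}"
      and m: "\<And>as. m \<le> length as \<Longrightarrow> card {y \<in> {1..n}. lie_pattern q as y \<in> avoiding S} \<le> 1"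
      using \<open>\<And>n. strategy_from (avoiding S) n (\<lambda>_. [])\<close>[of n]
      unfolding strategy_from_def survivors_def by auto
    show ?thesis
      unfolding seeker_wins_for_def by (intro exI[of _ q] conjI q exI[of _ m] allI impI m) simp
  qed
  then show "seeker_wins (avoiding S)"
    unfolding seeker_wins_def by blast
qed (rule wins_if_seeker_wins)

section \<open>Winning pairs\<close>

fun refutes :: "bit list list \<Rightarrow> bit list \<Rightarrow> bit list \<Rightarrow> bit list \<Rightarrow> bool" where
  "refutes ss es w w' \<longleftrightarrow> list_ex (\<lambda>s. sublist s w \<or> sublist s w') ss \<or>
    (case es of [] \<Rightarrow> False | e # es' \<Rightarrow>
      refutes ss es' (w @ [0]) (w' @ [e]) \<and> refutes ss es' (w @ [1]) (w' @ [1 + e]))"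

declare refutes.simps [simp del]

lemma wins_if_refutes: "refutes ss es w w' \<Longrightarrow> wins (avoiding (set ss)) w w'"
proof (induction ss es w w' rule: refutes.induct)
  case (1 ss es w w')
  show ?case
  proof (cases "list_ex (\<lambda>s. sublist s w \<or> sublist s w') ss")
    case True
    then show ?thesis by (intro wins.dead) (auto simp: avoiding_def list_ex_iff)
  next
    case False
    with "1.prems" obtain e es' where es: "es = e # es'"
      and r: "refutes ss es' (w @ [0]) (w' @ [e])" "refutes ss es' (w @ [1]) (w' @ [1 + e])"
      by (subst (asm) refutes.simps) (auto split: list.splits)
    show ?thesis
    proof (rule wins.ask)
      fix b show "wins (avoiding (set ss)) (w @ [b]) (w' @ [b + e])"
        using "1.IH"(1)[OF es r(1)] "1.IH"(2)[OF es r(2)] by (cases b; cases e) simp_all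
    qed
  qed
qed

text \<open>
  The third component is a sequence of choices of \<open>e\<close> that wins whatever the Obscurer answers;
  it was found by computer search.
\<close>

definition sporadic :: "(bit list \<times> bit list \<times> bit list) list" where
  "sporadic = [
    ([0, 0, 0], [1, 0, 1], [0, 0, 1, 0, 0]),
    ([0, 0, 0], [1, 0, 1, 1], [0, 0, 1, 0, 0, 0, 1, 0]),
    ([0, 0, 0], [1, 1, 0, 1], [0, 1, 0, 0, 0, 1, 0, 0]),
    ([0, 1, 0], [1, 1, 1], [0, 0, 1, 0, 0]),
    ([0, 1, 0], [0, 0, 1, 1], [1, 1, 1, 0, 0, 1, 0]),
    ([0, 1, 0], [0, 1, 1, 1], [1, 0, 0, 0, 1, 0, 0]),
    ([0, 1, 0], [1, 1, 0, 0], [0, 0, 1, 0, 1, 1, 1]),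
    ([0, 1, 0], [1, 1, 1, 0], [0, 0, 1, 0, 0, 0, 1]),
    ([0, 1, 0], [0, 0, 1, 1, 1], [1, 1, 1, 0, 0, 0, 0, 1, 0, 0, 0, 0, 1, 0, 0]),
    ([0, 1, 0], [1, 1, 1, 0, 0], [0, 0, 1, 0, 0, 0, 0, 1, 0, 0, 0, 0, 1, 1, 1]),
    ([1, 0, 1], [0, 0, 0, 1], [0, 0, 1, 0, 0, 0, 1]),
    ([1, 0, 1], [0, 0, 1, 1], [0, 0, 1, 0, 1, 1, 1]),
    ([1, 0, 1], [1, 0, 0, 0], [1, 0, 0, 0, 1, 0, 0]),
    ([1, 0, 1], [1, 1, 0, 0], [1, 1, 1, 0, 0, 1, 0]),
    ([1, 0, 1], [0, 0, 0, 1, 1], [0, 0, 1, 0, 0, 0, 0, 1, 0, 0, 0, 0, 1, 1, 1]),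
    ([1, 0, 1], [1, 1, 0, 0, 0], [1, 1, 1, 0, 0, 0, 0, 1, 0, 0, 0, 0, 1, 0, 0]),
    ([1, 1, 1], [0, 0, 1, 0], [0, 1, 0, 0, 0, 1, 0, 0]),
    ([1, 1, 1], [0, 1, 0, 0], [0, 0, 1, 0, 0, 0, 1, 0]),
    ([0, 0, 0, 1], [1, 0, 1, 1], [0, 0, 1, 0, 0, 0, 1, 0, 1, 1]),
    ([0, 0, 0, 1], [1, 1, 0, 1], [0, 1, 0, 0, 0, 1, 0, 0, 0, 1]),
    ([0, 0, 1, 0], [0, 1, 1, 1], [1, 1, 0, 1, 0, 0, 0, 1, 0, 0]),
    ([0, 0, 1, 0], [1, 1, 1, 0], [0, 1, 0, 0, 0, 1, 0, 0, 0, 1]),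
    ([0, 0, 1, 1], [0, 1, 0, 1], [1, 1, 1, 0, 0, 0, 1, 1, 1]),
    ([0, 1, 0, 0], [0, 1, 1, 1], [1, 0, 0, 0, 1, 0, 0, 0, 1, 0]),
    ([0, 1, 0, 0], [1, 1, 1, 0], [0, 0, 1, 0, 0, 0, 1, 0, 1, 1]),
    ([1, 0, 0, 0], [1, 0, 1, 1], [1, 0, 0, 0, 1, 0, 0, 0, 1, 0]),
    ([1, 0, 0, 0], [1, 1, 0, 1], [1, 1, 0, 1, 0, 0, 0, 1, 0, 0]),
    ([1, 0, 1, 0], [1, 1, 0, 0], [1, 1, 1, 0, 0, 0, 1, 1, 1])]"

lemma sporadic_refutes: "list_all (\<lambda>(s, t, es). refutes [s, t] es [] []) sporadic"
  by code_simp

lemma sporadic_wins: "(s, t, es) \<in> set sporadic \<Longrightarrow> wins (avoiding {s, t}) [] []"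
  using sporadic_refutes wins_if_refutes[of "[s, t]" es "[]" "[]"]
  by (auto simp: list_all_iff)

lemma wins_01: "wins (avoiding {[0, 1]}) [] []"
proof -
  \<comment> \<open>Different bits put a 0 in one word; the next equal bits must be 0, since 1 would
    complete \<open>[0, 1]\<close>; now both words end in 0 and one of them has to take a 1.\<close>
  have "refutes [[0, 1]] [1, 0, 1] [] []" by code_simp
  from wins_if_refutes[OF this] show ?thesis by simp
qed

section \<open>Complementation\<close>

definition flip :: "bit list \<Rightarrow> bit list" where
  "flip = map (\<lambda>b. 1 - b)"

lemma flip_simps [simp]: "flip [] = []" "flip (b # w) = (1 - b) # flip w"
  "flip (u @ w) = flip u @ flip w" "flip (flip w) = w"
  by (simp_all add: flip_def o_def map_idI)

lemma sublist_flip [simp]: "sublist (flip u) (flip w) \<longleftrightarrow> sublist u w"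
  by (metis flip_def flip_simps(4) map_mono_sublist)

lemma flip_in_avoiding: "flip w \<in> avoiding (flip ` S) \<longleftrightarrow> w \<in> avoiding S"
  by (simp add: avoiding_def)

text \<open>Complementing both bits does not change whether they agree, so the same choices of
  \<open>e\<close> win.\<close>

lemma wins_flip: "wins (avoiding S) w w' \<Longrightarrow> wins (avoiding (flip ` S)) (flip w) (flip w')"
proof (induction rule: wins.induct)
  case (dead w w')
  then show ?case by (intro wins.dead) (simp add: flip_in_avoiding)
next
  case (ask w w' e)
  show ?case
  proof (rule wins.ask)
    fix b show "wins (avoiding (flip ` S)) (flip w @ [b]) (flip w' @ [b + e])"
      using ask.IH[of "b + 1"] by (cases b; cases e) simp_all
  qed
qed

lemma wins_flip_iff: "wins (avoiding (flip ` S)) [] [] \<longleftrightarrow> wins (avoiding S) [] []"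
  using wins_flip[of S "[]" "[]"] wins_flip[of "flip ` S" "[]" "[]"]
  by (auto simp: image_image)

lemma wins_contains:
  "sublist v w \<Longrightarrow> v \<in> S \<Longrightarrow> wins (avoiding S) w w'"
  "sublist v w' \<Longrightarrow> v \<in> S \<Longrightarrow> wins (avoiding S) w w'"
  by (auto intro!: wins.dead simp: avoiding_def)

lemma avoiding_mono:
  assumes "\<And>s. s \<in> S \<Longrightarrow> \<exists>t\<in>T. sublist t s"
  shows "avoiding T \<subseteq> avoiding S"
  using assms sublist_order.order_trans unfolding avoiding_def by blast

section \<open>Forcing sharp words when \<open>00\<close> loses\<close>

definition sharp_word :: "nat \<Rightarrow> nat \<Rightarrow> bit list" where
  "sharp_word a j = replicate a 1 @ [0] @ concat (replicate j [1, 0]) @ replicate a 1"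

lemma ask_same:
  assumes "wins R (w @ [0]) (w' @ [0])" "wins R (w @ [1]) (w' @ [1])"
  shows "wins R w w'"
proof (rule wins.ask)
  fix b :: bit show "wins R (w @ [b]) (w' @ [b + 0])" using assms by (cases b) simp_all
qed

lemma ask_diff:
  assumes "wins R (w @ [0]) (w' @ [1])" "wins R (w @ [1]) (w' @ [0])"
  shows "wins R w w'"
proof (rule wins.ask)
  fix b :: bit show "wins R (w @ [b]) (w' @ [b + 1])" using assms by (cases b) simp_all
qed

text \<open>
  \<open>G\<close> is trivial when \<open>001\<close> is forbidden; when \<open>100\<close> is forbidden, it says that the word
  contains a \<open>1\<close>, after which no \<open>00\<close> can occur.
\<close>

locale losing_double_zero =
  fixes R :: "bit list set" and G :: "bit list \<Rightarrow> bool"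
  assumes G_append: "G w \<Longrightarrow> G (w @ x)"
    and double_zero: "G (w @ [0, 0]) \<Longrightarrow> G w' \<Longrightarrow> wins R (w @ [0, 0]) w'"
begin

text \<open>If equal bits are answered by zeros, the next different bits create \<open>00\<close> in
  one word and lose. So the Obscurer has to append ones to both.\<close>

lemma wins_append_ones:
  assumes "G w" "G w'" "wins R (w @ replicate k 1) (w' @ replicate k 1)"
  shows "wins R w w'"
  using assms
proof (induction k arbitrary: w w')
  case (Suc k)
  show ?case
  proof (rule ask_same)
    show "wins R (w @ [1]) (w' @ [1])"
      using Suc.IH[of "w @ [1]" "w' @ [1]"] Suc.prems by (simp add: G_append)
    show "wins R (w @ [0]) (w' @ [0])"
    proof (rule ask_diff)
      show "wins R ((w @ [0]) @ [0]) ((w' @ [0]) @ [1])"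
        using double_zero[of w "w' @ [0, 1]"] Suc.prems by (simp add: G_append)
      show "wins R ((w @ [0]) @ [1]) ((w' @ [0]) @ [0])"
        using double_zero[of w' "w @ [0, 1]"] Suc.prems by (simp add: G_append wins_sym)
    qed
  qed
qed simp

text \<open>The word ending in 0 cannot take another 0, so different bits force a 1 there and a 0 in
  the other word. This exchanges the roles; two rounds make one induction step.\<close>

lemma wins_append_alternating:
  assumes "G w" "G w'"
    and "wins R (w @ [0] @ concat (replicate j [1, 0])) (w' @ [1] @ concat (replicate j [0, 1]))"
  shows "wins R (w @ [0]) (w' @ [1])"
  using assms
proof (induction j arbitrary: w w')
  case (Suc j)
  show ?case
  proof (rule ask_diff)
    show "wins R ((w @ [0]) @ [0]) ((w' @ [1]) @ [1])"
      using double_zero[of w "w' @ [1, 1]"] Suc.prems by (simp add: G_append)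
    show "wins R ((w @ [0]) @ [1]) ((w' @ [1]) @ [0])"
    proof (rule ask_diff)
      show "wins R (((w @ [0]) @ [1]) @ [0]) (((w' @ [1]) @ [0]) @ [1])"
        using Suc.IH[of "w @ [0, 1]" "w' @ [1, 0]"] Suc.prems by (simp add: G_append)
      show "wins R (((w @ [0]) @ [1]) @ [1]) (((w' @ [1]) @ [0]) @ [0])"
        using double_zero[of "w' @ [1]" "w @ [0, 1, 1]"] Suc.prems
        by (simp add: G_append wins_sym)
    qed
  qed
qed simp

text \<open>After \<open>a\<close> common ones, different bits give one word a 0; alternation and
  then common ones complete \<open>sharp_word a j\<close> in that word.\<close>

lemma wins_sharp_word:
  assumes "R \<subseteq> avoiding {sharp_word a j}" "G w" "G w'"
  shows "wins R w w'"
proof -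
  have diff: "wins R (x @ replicate a 1 @ [0]) (x' @ replicate a 1 @ [1])" if "G x" "G x'" for x x'
  proof -
    let ?y = "x @ replicate a 1 @ [0] @ concat (replicate j [1, 0])"
    let ?y' = "x' @ replicate a 1 @ [1] @ concat (replicate j [0, 1])"
    have "?y @ replicate a 1 = x @ sharp_word a j"
      by (simp add: sharp_word_def)
    then have "?y @ replicate a 1 \<notin> R"
      using assms(1) by (auto simp: avoiding_def)
    then have "wins R ?y ?y'"
      using that by (intro wins_append_ones[of ?y ?y' a] G_append wins.dead) blast+
    then show ?thesis
      using wins_append_alternating[of "x @ replicate a 1" "x' @ replicate a 1" j] that
      by (simp add: G_append)
  qed
  show ?thesis
  proof (rule wins_append_ones[OF assms(2,3), of a], rule ask_diff)
    show "wins R ((w @ replicate a 1) @ [0]) ((w' @ replicate a 1) @ [1])"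
      using diff[OF assms(2,3)] by simp
    show "wins R ((w @ replicate a 1) @ [1]) ((w' @ replicate a 1) @ [0])"
      using diff[OF assms(3,2)] by (simp add: wins_sym)
  qed
qed

end

text \<open>A 1 is fatal to the first word at any time, so it takes only zeros and the choices of
  \<open>e\<close>, namely the letters of \<open>v\<close>, dictate the second word.\<close>

lemma wins_force:
  assumes "wins (avoiding S) (w @ replicate (length v) 0) (w' @ v)"
    and "\<And>k. w @ replicate k 0 @ [1] \<notin> avoiding S"
  shows "wins (avoiding S) w w'"
  using assms
proof (induction v arbitrary: w w')
  case (Cons e v)
  have "w @ [1] \<notin> avoiding S"
    using Cons.prems(2)[of 0] by simp
  moreover have "wins (avoiding S) (w @ [0]) (w' @ [e])"
    using Cons.prems(1) Cons.prems(2)[of "Suc k" for k] Cons.IH[of "w @ [0]" "w' @ [e]"] by simp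
  ultimately have "wins (avoiding S) (w @ [b]) (w' @ [b + e])" for b
    by (cases b) (auto intro: wins.dead)
  then show ?case by (rule wins.ask)
qed simp

text \<open>Once a word ends in \<open>00\<close>, any later 1 completes \<open>001\<close>. By
  \<open>wins_force\<close> the other word can then be made to spell the sharp word, so
  \<open>00\<close> loses.\<close>

lemma wins_001_sharp_word: "wins (avoiding {[0, 0, 1], sharp_word a j}) [] []"
proof -
  let ?S = "{[0, 0, 1], sharp_word a j}"
  interpret losing_double_zero "avoiding ?S" "\<lambda>_. True"
  proof
    fix w w' :: "bit list"
    have "(w @ [0, 0]) @ replicate k 0 @ [1] = (w @ replicate k 0) @ [0, 0, 1] @ []" for k
      by (simp flip: replicate_Suc add: replicate_app_Cons_same)
    then have "sublist [0, 0, 1] ((w @ [0, 0]) @ replicate k 0 @ [1])" for k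
      by (metis sublist_appendI)
    then have "(w @ [0, 0]) @ replicate k 0 @ [1] \<notin> avoiding ?S" for k
      unfolding avoiding_def by blast
    moreover have "wins (avoiding ?S) u (w' @ sharp_word a j)" for u
      by (rule wins_contains(2)[of "sharp_word a j"]) auto
    ultimately show "wins (avoiding ?S) (w @ [0, 0]) w'"
      by (rule wins_force[rotated])
  qed simp
  show ?thesis by (rule wins_sharp_word[of a j]) (auto simp: avoiding_def)
qed

lemma sublist_100_if_double_zero:
  assumes "(1 :: bit) \<in> set w"
  shows "sublist [1, 0, 0] (w @ [0, 0])"
proof -
  obtain xs ys where w: "w = xs @ 1 # ys" and "1 \<notin> set ys"
    using split_list_last[OF assms] by blast
  then have "ys = replicate (length ys) 0"
    by (metis bit_not_one_iff replicate_eqI)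
  then obtain k where "w = xs @ 1 # replicate k 0" using w by blast
  then have "w @ [0, 0] = xs @ [1, 0, 0] @ replicate k 0"
    by (simp add: replicate_app_Cons_same)
  then show ?thesis by (metis sublist_appendI)
qed

text \<open>The locale applies once both words contain a 1, so the Seeker first brings this
  about.\<close>

lemma wins_100_sharp_word: "wins (avoiding {[1, 0, 0], sharp_word a j}) [] []"
proof -
  let ?S = "{[1, 0, 0], sharp_word a j}"
  interpret losing_double_zero "avoiding ?S" "\<lambda>w. 1 \<in> set w"
  proof
    fix w w' :: "bit list" assume "1 \<in> set (w @ [0, 0])"
    then show "wins (avoiding ?S) (w @ [0, 0]) w'"
      by (intro wins_contains(1)[OF sublist_100_if_double_zero]) auto
  qed simp
  have ones: "wins (avoiding ?S) w w'" if "1 \<in> set w" "1 \<in> set w'" for w w'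
    using that by (intro wins_sharp_word[of a j]) (auto simp: avoiding_def)
  \<comment> \<open>Equal bits twice: a 1 gives both words a 1, and two zeros turn
    \<open>[0, 1]\<close> into a word containing \<open>100\<close>.\<close>
  have 0: "wins (avoiding ?S) [0, 0] [0, 1]"
  proof (rule ask_same)
    show "wins (avoiding ?S) ([0, 0] @ [0]) ([0, 1] @ [0])"
    proof (rule ask_same)
      show "wins (avoiding ?S) (([0, 0] @ [0]) @ [0]) (([0, 1] @ [0]) @ [0])"
        using wins_contains(2)[of "[1, 0, 0]" "[0, 1, 0, 0]" ?S] sublist_append_leftI[of "[1, 0, 0]" "[0]"]
        by simp
    qed (simp add: ones)
  qed (simp add: ones)
  show ?thesis
  proof (rule ask_same)
    show "wins (avoiding ?S) ([] @ [0]) ([] @ [0])"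
      by (rule ask_diff) (simp_all add: 0 wins_sym)
  qed (simp add: ones)
qed

section \<open>The shape of \<open>R_sharp\<close>\<close>

lemma R_sharp_iff: "v \<in> R_sharp \<longleftrightarrow> (\<forall>k. sublist (0 # replicate k 1 @ [0]) v \<longrightarrow> k = 1)"
proof -
  have "(k = 0 \<or> k \<ge> 2) \<longleftrightarrow> k \<noteq> 1" for k :: nat by auto
  then show ?thesis unfolding R_sharp_def avoiding_def by blast
qed

text \<open>Build the word from the right: a 1 in front lengthens the left run of ones, while a 0 in
  front of \<open>1\<^sup>a0\<close> requires \<open>a = 1\<close> and extends the alternating
  part.\<close>

lemma R_sharp_cases:
  assumes "v \<in> R_sharp"
  obtains c where "v = replicate c 1"
  | a j c where "v = replicate a 1 @ [0] @ concat (replicate j [1, 0]) @ replicate c 1"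
proof -
  have "(\<exists>c. v = replicate c 1) \<or>
      (\<exists>a j c. v = replicate a 1 @ [0] @ concat (replicate j [1, 0]) @ replicate c 1)"
    using assms
  proof (induction v)
    case Nil
    then show ?case by (metis replicate_0)
  next
    case (Cons b v)
    have v: "v \<in> R_sharp"
      using Cons.prems avoiding_sublist[of "b # v" _ v] by (simp add: R_sharp_def sublist_Cons_right)
    from Cons.IH[OF v] show ?case
    proof (elim disjE exE)
      fix c assume c: "v = replicate c 1"
      show ?case
      proof (cases b)
        case zero
        then have "b # v = replicate 0 1 @ [0] @ concat (replicate 0 [1, 0]) @ replicate c 1"
          using c by simp
        then show ?thesis by blast
      next
        case one
        then show ?thesis using c by (metis replicate_Suc)
      qed
    next
      fix a j c assume v: "v = replicate a 1 @ [0] @ concat (replicate j [1, 0]) @ replicate c 1"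
      show ?case
      proof (cases b)
        case zero
        have "b # v = [] @ (0 # replicate a 1 @ [0]) @ concat (replicate j [1, 0]) @ replicate c 1"
          using v zero by simp
        then have "sublist (0 # replicate a 1 @ [0]) (b # v)"
          by (metis sublist_appendI)
        then have "a = 1"
          using Cons.prems by (simp add: R_sharp_iff)
        then have "b # v = replicate 0 1 @ [0] @ concat (replicate (Suc j) [1, 0]) @ replicate c 1"
          using v zero by simp
        then show ?thesis by blast
      next
        case one
        then have "b # v = replicate (Suc a) 1 @ [0] @ concat (replicate j [1, 0]) @ replicate c 1"
          using v by simp
        then show ?thesis by blast
      qed
    qed
  qed
  then show thesis using that by blast
qed

text \<open>Lengthening the shorter outer run of ones to match the longer makes the word symmetric,
  which is why \<open>sharp_word\<close> has one exponent for both runs.\<close>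

lemma sublist_sharp_word:
  assumes "v \<in> R_sharp"
  shows "\<exists>a j. sublist v (sharp_word a j)"
  using assms
proof (cases rule: R_sharp_cases)
  case (1 c)
  then show ?thesis by (auto simp: sharp_word_def)
next
  case (2 a j c)
  let ?m = "max a c"
  let ?u = "[0] @ concat (replicate j [1, 0])"
  have left: "replicate ?m (1 :: bit) = replicate (?m - a) 1 @ replicate a 1"
    using replicate_add[of "?m - a" a "1 :: bit"] by simp
  have right: "replicate ?m (1 :: bit) = replicate c 1 @ replicate (?m - c) 1"
    using replicate_add[of c "?m - c" "1 :: bit"] by simp
  have "sharp_word ?m j = replicate ?m 1 @ ?u @ replicate ?m 1"
    by (simp add: sharp_word_def)
  also have "\<dots> = (replicate (?m - a) 1 @ replicate a 1) @ ?u @ replicate ?m 1"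
    by (simp only: left)
  also have "\<dots> = (replicate (?m - a) 1 @ replicate a 1) @ ?u @ replicate c 1 @ replicate (?m - c) 1"
    by (simp only: right)
  finally have "sharp_word ?m j = replicate (?m - a) 1 @ v @ replicate (?m - c) 1"
    by (simp add: 2)
  then show ?thesis by (metis sublist_appendI)
qed

text \<open>Replacing forbidden words by factors only helps the Seeker, and \<open>00\<close> is a
  factor of \<open>001\<close>, so \<open>001\<close> and \<open>100\<close> are the only
  cases.\<close>

lemma wins_sharp:
  assumes "u \<in> {[0, 0], [0, 0, 1], [1, 0, 0]}" "v \<in> R_sharp"
  shows "wins (avoiding {u, v}) [] []"
proof -
  obtain a j where v: "sublist v (sharp_word a j)"
    using sublist_sharp_word[OF assms(2)] by blast
  have mono: "avoiding {u, v} \<subseteq> avoiding {t, sharp_word a j}" if "sublist u t" for t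
    using that v by (intro avoiding_mono) auto
  have "sublist u [0, 0, 1] \<or> sublist u [1, 0, 0]"
    using assms(1) by (auto simp: sublist_Cons_right)
  then show ?thesis
    by (elim disjE) (rule wins_mono[OF wins_001_sharp_word mono] wins_mono[OF wins_100_sharp_word mono],
      assumption)+
qed

lemma wins_sharp_inv:
  assumes "u \<in> {[1, 1], [0, 1, 1], [1, 1, 0]}" "v \<in> R_sharp_inv"
  shows "wins (avoiding {u, v}) [] []"
proof -
  obtain v' where v': "v = flip v'" "v' \<in> R_sharp"
    using assms(2) by (auto simp: R_sharp_inv_def flip_def)
  have "flip u \<in> {[0, 0], [0, 0, 1], [1, 0, 0]}"
    using assms(1) by auto
  from wins_sharp[OF this v'(2)] wins_flip_iff[of "{flip u, v'}"] show ?thesis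
    by (simp add: v'(1))
qed

section \<open>Losing pairs\<close>

text \<open>Forbidden factors remain when a past is put in front. Contrapositively, the Obscurer may
  be assumed to start from any position.\<close>

lemma wins_append:
  assumes "wins (avoiding S) w w'"
  shows "wins (avoiding S) (x @ w) (y @ w')"
  using assms
proof (induction rule: wins.induct)
  case (dead w w')
  then have "x @ w \<notin> avoiding S \<or> y @ w' \<notin> avoiding S"
    using avoiding_sublist[OF _ sublist_append_leftI] by blast
  then show ?case by (rule wins.dead)
next
  case (ask w w' e)
  show ?case by (rule wins.ask[where e = e]) (use ask.IH in simp)
qed

lemma not_wins_if_invariant:
  assumes "I u u'"
    and "\<And>w w'. I w w' \<Longrightarrow> w \<in> avoiding S \<and> w' \<in> avoiding S"
    and "\<And>w w' e. I w w' \<Longrightarrow> \<exists>b. I (w @ [b]) (w' @ [b + e])"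
  shows "\<not> wins (avoiding S) [] []"
proof -
  have "\<not> I w w'" if "wins (avoiding S) w w'" for w w'
    using that
  proof (induction rule: wins.induct)
    case (dead w w')
    then show ?case using assms(2) by blast
  next
    case (ask w w' e)
    then show ?case using assms(3)[of w w' e] by blast
  qed
  from this[of u u'] show ?thesis
    using assms(1) wins_append[of S "[]" "[]" u u'] by auto
qed

lemma avoiding_snoc:
  assumes "w \<in> avoiding S" "\<And>s. s \<in> S \<Longrightarrow> \<not> suffix s (w @ [b])"
  shows "w @ [b] \<in> avoiding S"
  using assms unfolding avoiding_def by (auto simp: sublist_snoc)

section \<open>The Obscurer against \<open>00\<close> and \<open>01\<^sup>k0\<close>\<close>

lemma suffix_run_iff:
  "suffix (0 # replicate k (1 :: bit)) (x @ 0 # replicate a 1) \<longleftrightarrow> k = a"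
proof
  assume "suffix (0 # replicate k (1 :: bit)) (x @ 0 # replicate a 1)"
  then obtain y where "x @ 0 # replicate a (1 :: bit) = y @ 0 # replicate k 1"
    by (auto simp: suffix_def)
  \<comment> \<open>The final runs of ones are compared as initial runs of the reversed
    words.\<close>
  then have "takeWhile (\<lambda>b. b = 1) (rev (x @ 0 # replicate a (1 :: bit))) =
      takeWhile (\<lambda>b. b = 1) (rev (y @ 0 # replicate k 1))"
    by (rule arg_cong)
  then have "replicate a (1 :: bit) = replicate k 1"
    by (simp add: takeWhile_append)
  then show "k = a" by (metis length_replicate)
qed (simp add: suffix_def)

text \<open>Appending 0 is fatal exactly after a final run of ones of length 0 or \<open>k\<close>.
  Common ones preserve the difference of the runs, and by the invariant one of the two words can
  always take a 0.\<close>

lemma not_wins_00_run: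
  assumes "k \<ge> 2"
  shows "\<not> wins (avoiding {[0, 0], 0 # replicate k 1 @ [0]}) [] []"
proof -
  let ?S = "{[0, 0], 0 # replicate k 1 @ [0]} :: bit list set"
  define run where "run a w \<longleftrightarrow> w \<in> avoiding ?S \<and> (\<exists>x. w = x @ 0 # replicate a 1)" for a w
  define I where "I w w' \<longleftrightarrow>
    (\<exists>a a'. run a w \<and> run a' w' \<and> a \<noteq> a' \<and> a \<noteq> a' + k \<and> a' \<noteq> a + k)" for w w'
  have one: "run (Suc a) (w @ [1])" if "run a w" for a w
  proof -
    have "w @ [1] \<in> avoiding ?S"
      using that unfolding run_def by (intro avoiding_snoc) (auto simp: suffix_def)
    then show ?thesis
      using that unfolding run_def by (auto simp: replicate_append_same)
  qed
  have zero: "run 0 (w @ [0])" if a: "run a w" "a \<noteq> 0" "a \<noteq> k" for a w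
  proof -
    obtain x where w: "w = x @ 0 # replicate a 1" using a(1) by (auto simp: run_def)
    have "\<not> suffix s (w @ [0])" if "s \<in> ?S" for s
    proof (cases "s = [0, 0]")
      case True
      have "\<not> suffix ([0] @ [0]) (w @ [0])"
        using suffix_run_iff[of 0 x a] a(2) by (simp only: snoc_suffix_snoc w) simp
      then show ?thesis using True by simp
    next
      case False
      then have s: "s = (0 # replicate k 1) @ [0]" using that by simp
      show ?thesis
        using suffix_run_iff[of k x a] a(3) by (simp only: snoc_suffix_snoc w s) simp
    qed
    then have "w @ [0] \<in> avoiding ?S"
      using a(1) by (intro avoiding_snoc) (auto simp: run_def)
    then show ?thesis by (auto simp: run_def)
  qed
  have start: "run 0 [0]"
    using assms by (auto simp: run_def avoiding_def sublist_Cons_right)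
  show ?thesis
  proof (rule not_wins_if_invariant)
    show "I [0] ([0] @ [1])"
      unfolding I_def using assms start one[OF start] by (intro exI[of _ 0] exI[of _ 1]) auto
  next
    fix w w' assume "I w w'"
    then show "w \<in> avoiding ?S \<and> w' \<in> avoiding ?S"
      by (auto simp: I_def run_def)
  next
    fix w w' e assume "I w w'"
    then obtain a a' where a: "run a w" "run a' w'" "a \<noteq> a'" "a \<noteq> a' + k" "a' \<noteq> a + k"
      by (auto simp: I_def)
    show "\<exists>b. I (w @ [b]) (w' @ [b + e])"
    proof (cases e)
      case zero
      have "I (w @ [1]) (w' @ [1])"
        unfolding I_def using a one[OF a(1)] one[OF a(2)]
        by (intro exI[of _ "Suc a"] exI[of _ "Suc a'"]) auto
      then show ?thesis using zero by auto
    next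
      case e: one
      show ?thesis
      proof (cases "a \<noteq> 0 \<and> a \<noteq> k \<and> Suc a' \<noteq> k")
        case True
        then have "I (w @ [0]) (w' @ [1])"
          unfolding I_def using zero[OF a(1)] one[OF a(2)] assms
          by (intro exI[of _ 0] exI[of _ "Suc a'"]) auto
        then show ?thesis using e by (intro exI[of _ 0]) simp
      next
        case False
        \<comment> \<open>Each of \<open>a = 0\<close>, \<open>a = k\<close> and
          \<open>Suc a' = k\<close> makes a 0 acceptable for \<open>w'\<close>: its run is neither 0
          nor \<open>k\<close>, and the new runs \<open>Suc a\<close> and 0 do not differ by 0 or
          \<open>k\<close>.\<close>
        then have "a' \<noteq> 0" "a' \<noteq> k" "Suc a \<noteq> k" using a(3-5) assms by auto
        then have "I (w @ [1]) (w' @ [0])"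
          unfolding I_def using one[OF a(1)] zero[OF a(2)] assms
          by (intro exI[of _ "Suc a"] exI[of _ 0]) auto
        then show ?thesis using e by (intro exI[of _ 1]) simp
      qed
    qed
  qed
qed

section \<open>Finite certificates for the Obscurer\<close>

text \<open>
  The second conjunct is needed because \<open>u\<close> is only a suffix of the pattern played so far, which
  may make \<open>u @ [b]\<close> the end of an occurrence of \<open>s\<close> that starts before \<open>u\<close>.
\<close>

definition safe :: "bit list list \<Rightarrow> bit list \<Rightarrow> bit \<Rightarrow> bool" where
  "safe ss u b \<longleftrightarrow> list_all (\<lambda>s. \<not> suffix s (u @ [b]) \<and> \<not> suffix (u @ [b]) s) ss"

definition covers :: "(bit list \<times> bit list) list \<Rightarrow> bit list \<Rightarrow> bit list \<Rightarrow> bool" where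
  "covers I w w' \<longleftrightarrow>
    list_ex (\<lambda>(u, u'). suffix u w \<and> suffix u' w' \<or> suffix u' w \<and> suffix u w') I"

definition evades :: "bit list list \<Rightarrow> (bit list \<times> bit list) list \<Rightarrow> bool" where
  "evades ss I \<longleftrightarrow>
    list_ex (\<lambda>(u, u'). list_all (\<lambda>s. \<not> sublist s u \<and> \<not> sublist s u') ss) I \<and>
    list_all (\<lambda>(u, u'). list_all (\<lambda>e. list_ex (\<lambda>b.
      safe ss u b \<and> safe ss u' (b + e) \<and> covers I (u @ [b]) (u' @ [b + e])) [0, 1]) [0, 1]) I"

lemma safe_avoiding:
  assumes "safe ss u b" "suffix u w" "w \<in> avoiding (set ss)"
  shows "w @ [b] \<in> avoiding (set ss)"
proof (rule avoiding_snoc[OF assms(3)])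
  fix s assume "s \<in> set ss"
  then have "\<not> suffix s (u @ [b])" "\<not> suffix (u @ [b]) s"
    using assms(1) by (auto simp: safe_def list_all_iff)
  moreover have "suffix (u @ [b]) (w @ [b])"
    using assms(2) by simp
  ultimately show "\<not> suffix s (w @ [b])"
    using suffix_same_cases by blast
qed

lemma covers_sym: "covers I w w' \<Longrightarrow> covers I w' w"
  by (auto simp: covers_def list_ex_iff)

lemma covers_suffix:
  assumes "covers I w w'" "suffix w x" "suffix w' x'"
  shows "covers I x x'"
proof -
  have "suffix u x" if "suffix u w" for u
    using that assms(2) by (rule suffix_order.order_trans)
  moreover have "suffix u x'" if "suffix u w'" for u
    using that assms(3) by (rule suffix_order.order_trans)
  ultimately show ?thesis
    using assms(1) unfolding covers_def list_ex_iff by fast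
qed

lemma not_wins_if_evades:
  assumes "evades ss I"
  shows "\<not> wins (avoiding (set ss)) [] []"
proof -
  let ?R = "avoiding (set ss)"
  obtain u u' where u: "(u, u') \<in> set I" "u \<in> ?R" "u' \<in> ?R"
    using assms by (auto simp: evades_def list_all_iff list_ex_iff avoiding_def)
  have step: "\<exists>b. w @ [b] \<in> ?R \<and> w' @ [b + e] \<in> ?R \<and> covers I (w @ [b]) (w' @ [b + e])"
    if v: "(v, v') \<in> set I" "suffix v w" "suffix v' w'" "w \<in> ?R" "w' \<in> ?R" for v v' w w' e
  proof -
    have "e \<in> set [0, 1]" by (cases e) simp_all
    then obtain b where b: "safe ss v b" "safe ss v' (b + e)" "covers I (v @ [b]) (v' @ [b + e])"
      using assms v(1) unfolding evades_def list_all_iff list_ex_iff by blast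
    then show ?thesis
      using v safe_avoiding covers_suffix[OF b(3), of "w @ [b]" "w' @ [b + e]"]
      by (intro exI[of _ b]) auto
  qed
  show ?thesis
  proof (rule not_wins_if_invariant)
    show "u \<in> ?R \<and> u' \<in> ?R \<and> covers I u u'"
      using u by (auto simp: covers_def list_ex_iff)
  next
    fix w w' e assume w: "w \<in> ?R \<and> w' \<in> ?R \<and> covers I w w'"
    then obtain v v' where v: "(v, v') \<in> set I"
      "suffix v w \<and> suffix v' w' \<or> suffix v' w \<and> suffix v w'"
      by (auto simp: covers_def list_ex_iff)
    from v(2) show "\<exists>b. w @ [b] \<in> ?R \<and> w' @ [b + e] \<in> ?R \<and> covers I (w @ [b]) (w' @ [b + e])"
    proof (elim disjE conjE)
      assume "suffix v w" "suffix v' w'"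
      then show ?thesis using step[OF v(1)] w by blast
    next
      assume "suffix v' w" "suffix v w'"
      \<comment> \<open>In the exchanged position \<open>b\<close> goes to the second word, so the
        first receives \<open>b + e\<close>; adding \<open>e\<close> twice gives 0 in
        \<open>bit\<close>.\<close>
      then obtain b where "w' @ [b] \<in> ?R" "w @ [b + e] \<in> ?R" "covers I (w' @ [b]) (w @ [b + e])"
        using step[OF v(1)] w by blast
      moreover have "b + e + e = b" by (cases b; cases e) simp_all
      ultimately show ?thesis
        by (intro exI[of _ "b + e"]) (simp add: covers_sym)
    qed
  qed blast
qed

text \<open>
  The third component lists pairs of suffixes, up to exchanging the two candidates, among which the
  Obscurer can stay forever; these were found by computer search.
\<close>

definition evasions :: "(bit list \<times> bit list \<times> (bit list \<times> bit list) list) list" where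
  "evasions = [
    ([0, 0, 0], [0, 1, 0],
      [([], [1, 1]), ([1], [1, 0])]),
    ([0, 0, 0], [1, 1, 1],
      [([0], [1, 0]), ([0, 1], [1]), ([0], [0, 1]), ([1], [1, 0])]),
    ([0, 0, 0], [1, 1, 0, 1, 1],
      [([0], [0, 0, 1]), ([0, 1], [1, 1]), ([1], [1, 0]), ([0, 1, 0], [1, 0]),
       ([0, 0], [1, 0]), ([0, 1, 0, 1], [1]), ([0], [0, 1, 0, 1]), ([0, 0, 1], [1])]),
    ([0, 1, 0], [1, 0, 1],
      [([1], [1, 1]), ([0], [1, 1]), ([0], [0, 0]), ([0, 0], [1])]),
    ([0, 1, 0], [0, 1, 1, 0],
      [([0], [1, 1]), ([1], [1, 1, 1])]),
    ([0, 1, 0], [1, 0, 0, 1],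
      [([0, 0], [1, 0]), ([0, 0], [0, 0, 0]), ([0, 0, 0], [1]), ([1], [1, 1]), ([0], [1, 1])]),
    ([0, 1, 0], [1, 1, 1, 1],
      [([0, 1], [0, 1, 1]), ([0, 1, 1], [1, 1]), ([0], [1, 1]), ([0], [0]), ([0], [0, 1])]),
    ([0, 1, 0], [0, 1, 1, 1, 0],
      [([0, 1], [0, 1, 1]), ([0, 1, 1], [1, 1, 1]), ([0], [0, 1, 1]), ([1, 1], [1, 1, 1, 1]),
       ([0], [1, 1, 1]), ([0], [0]), ([0, 1], [1, 1, 1, 1]), ([0], [0, 1])]),
    ([0, 0, 1, 1], [1, 0, 1, 0],
      [([1, 0, 1], [1, 1]), ([1, 1], [1, 1]), ([0], [1, 1]), ([0], [0, 0]),
       ([0, 0], [0, 0, 1]), ([0, 0, 1], [1, 0]), ([1, 0], [1, 0, 1])])]"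

lemma evasions_evade: "list_all (\<lambda>(s, t, I). evades [s, t] I) evasions"
  by code_simp

lemma evasions_not_wins: "(s, t, I) \<in> set evasions \<Longrightarrow> \<not> wins (avoiding {s, t}) [] []"
  using evasions_evade not_wins_if_evades[of "[s, t]" I] by (auto simp: list_all_iff)

section \<open>Exhaustion of all pairs\<close>

lemma not_wins_sublist:
  assumes "\<not> wins (avoiding {a, b}) [] []" "sublist a s" "sublist b t"
  shows "\<not> wins (avoiding {s, t}) [] []"
proof -
  have "avoiding {a, b} \<subseteq> avoiding {s, t}"
    using assms(2,3) by (intro avoiding_mono) auto
  then show ?thesis using assms(1) wins_mono by blast
qed

text \<open>The Obscurer survives even if \<open>0110\<close> is forbidden as well. Equal components
  stand for one word contained in both members of a pair.\<close>

lemma not_wins_00_00: "\<not> wins (avoiding {[0, 0], [0, 0]}) [] []"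
proof -
  have "avoiding {[0, 0], 0 # replicate 2 1 @ [0]} \<subseteq> avoiding {[0, 0], [0, 0]}"
    by (rule avoiding_mono) auto
  then show ?thesis using not_wins_00_run[of 2] wins_mono by blast
qed

lemma not_wins_not_sharp:
  assumes "u \<in> {[0, 0], [0, 0, 1], [1, 0, 0]}" "v \<notin> R_sharp"
  shows "\<not> wins (avoiding {u, v}) [] []"
proof -
  have u: "sublist [0, 0] u"
    using assms(1) by (auto simp: sublist_Cons_right)
  obtain k where k: "sublist (0 # replicate k 1 @ [0]) v" "k \<noteq> 1"
    using assms(2) by (auto simp: R_sharp_iff)
  show ?thesis
  proof (cases "k = 0")
    case True
    then show ?thesis using not_wins_sublist[OF not_wins_00_00 u, of v] k(1) by simp
  next
    case False
    then show ?thesis using not_wins_sublist[OF not_wins_00_run u k(1)] k(2) by simp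
  qed
qed

lemma not_wins_not_sharp_inv:
  assumes "u \<in> {[1, 1], [0, 1, 1], [1, 1, 0]}" "v \<notin> R_sharp_inv"
  shows "\<not> wins (avoiding {u, v}) [] []"
proof -
  have "flip u \<in> {[0, 0], [0, 0, 1], [1, 0, 0]}"
    using assms(1) by auto
  moreover have "flip v \<notin> R_sharp"
    using assms(2) by (metis R_sharp_inv_def flip_def flip_simps(4) image_eqI)
  ultimately show ?thesis
    using not_wins_not_sharp[of "flip u" "flip v"] wins_flip_iff[of "{u, v}"] by simp
qed

text \<open>Runs of up to four ones suffice because the words tested later have at most six
  letters.\<close>

definition evasive_pairs :: "(bit list \<times> bit list) list" where
  "evasive_pairs =
    [([0, 0], [0, 0]), ([0, 1, 0], [0, 1, 0]), ([0, 0], [0, 1, 1, 0]), ([0, 0], [0, 1, 1, 1, 0]),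
     ([0, 0], [0, 1, 1, 1, 1, 0])] @ map (\<lambda>(s, t, I). (s, t)) evasions"

lemma evasive_pairs_not_wins:
  assumes "(s, t) \<in> set evasive_pairs"
  shows "\<not> wins (avoiding {s, t}) [] []"
proof -
  have "\<not> wins (avoiding {[0, 0], 0 # replicate k 1 @ [0]}) [] []" if "k \<in> {2, 3, 4}" for k
    using that by (intro not_wins_00_run) auto
  from this[of 2] this[of 3] this[of 4]
  have runs: "\<not> wins (avoiding {[0, 0], [0, 1, 1, 0]}) [] []"
    "\<not> wins (avoiding {[0, 0], [0, 1, 1, 1, 0]}) [] []"
    "\<not> wins (avoiding {[0, 0], [0, 1, 1, 1, 1, 0]}) [] []"
    by (simp_all add: numeral_eq_Suc)
  have "avoiding {[0, 1, 0], [1, 0, 1]} \<subseteq> avoiding {[0, 1, 0], [0, 1, 0]}"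
    by (rule avoiding_mono) auto
  moreover have "\<not> wins (avoiding {[0, 1, 0], [1, 0, 1]}) [] []"
    by (rule evasions_not_wins[of _ _ "[([1], [1, 1]), ([0], [1, 1]), ([0], [0, 0]), ([0, 0], [1])]"])
       (simp add: evasions_def)
  ultimately have "\<not> wins (avoiding {[0, 1, 0], [0, 1, 0]}) [] []"
    using wins_mono by blast
  with assms runs not_wins_00_00 show ?thesis
    unfolding evasive_pairs_def using evasions_not_wins by auto
qed

text \<open>Exchange and complementation turn each evasive pair into four ordered ones. The words
  listed must not occur in the other member of a pair with \<open>s\<close> if the Seeker is to
  win.\<close>

definition partners :: "bit list \<Rightarrow> bit list list" where
  "partners s = map snd (filter (\<lambda>(a, b). sublist a s)
    (concat (map (\<lambda>(a, b). [(a, b), (b, a), (flip a, flip b), (flip b, flip a)]) evasive_pairs)))"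

definition unbeaten :: "bit list list \<Rightarrow> bit list list \<Rightarrow> bit list list" where
  "unbeaten P W = filter (\<lambda>t. \<not> list_ex (\<lambda>b. sublist b t) P) W"

lemma partners_not_wins:
  assumes "b \<in> set (partners s)" "sublist b t"
  shows "\<not> wins (avoiding {s, t}) [] []"
proof -
  obtain a where a: "sublist a s" and "(a, b) \<in> set evasive_pairs \<or> (b, a) \<in> set evasive_pairs \<or>
      (flip a, flip b) \<in> set evasive_pairs \<or> (flip b, flip a) \<in> set evasive_pairs"
    using assms(1) by (auto simp: partners_def)
  moreover have "\<not> wins (avoiding {x, y}) [] []" "\<not> wins (avoiding {y, x}) [] []"
    if "(x, y) \<in> set evasive_pairs" for x y
    using evasive_pairs_not_wins[OF that] by (simp_all add: insert_commute)
  ultimately have "\<not> wins (avoiding {a, b}) [] []"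
    using wins_flip_iff[of "{a, b}"] by auto
  then show ?thesis using a assms(2) by (rule not_wins_sublist)
qed

lemma mem_unbeaten:
  assumes "wins (avoiding {s, t}) [] []" "sublist s' s" "sublist t' t" "t' \<in> set W"
  shows "t' \<in> set (unbeaten (partners s') W)"
proof -
  have "\<not> sublist b t'" if "b \<in> set (partners s')" for b
    using partners_not_wins[OF that] not_wins_sublist[OF _ assms(2,3)] assms(1) by blast
  then show ?thesis using assms(4) by (auto simp: unbeaten_def list_ex_iff)
qed

section \<open>The finite search\<close>

definition words :: "nat \<Rightarrow> bit list list" where
  "words n = List.n_lists n [0, 1]"

lemma set_words: "set (words n) = {w. length w = n}"
proof -
  have "set w \<subseteq> {0, 1}" for w :: "bit list"
    by (metis bit_not_zero_iff insertCI subsetI)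
  then show ?thesis by (auto simp: words_def set_n_lists)
qed

text \<open>Every nonempty word outside the special words of (a) and (c) has one of these as a
  factor: it is one of the three-letter words or has a four-letter prefix.\<close>

definition long_seeds :: "bit list list" where
  "long_seeds = [[0, 0, 0], [0, 1, 0], [1, 0, 1], [1, 1, 1]] @ words 4"

text \<open>This bounds the search: a word of six or more letters has a six-letter factor, and the
  Obscurer beats it paired with any seed.\<close>

lemma unbeaten_long: "list_all (\<lambda>s. unbeaten (partners s) long_seeds = []) (words 6)"
  by code_simp

definition short_words :: "bit list list" where
  "short_words = [[0, 0, 0], [0, 1, 0], [1, 0, 1], [1, 1, 1]] @ words 4 @ words 5"

lemma unbeaten_short: "list_all (\<lambda>s. list_all (\<lambda>t.
    list_ex (\<lambda>(a, b, es). a = s \<and> b = t \<or> a = t \<and> b = s) sporadic)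
      (unbeaten (partners s) short_words)) short_words"
  by code_simp

lemma no_win_long:
  assumes "length s \<ge> 6" "t \<in> {[0, 0, 0], [0, 1, 0], [1, 0, 1], [1, 1, 1]} \<or> length t \<ge> 4"
  shows "\<not> wins (avoiding {s, t}) [] []"
proof
  assume w: "wins (avoiding {s, t}) [] []"
  obtain t' where t': "sublist t' t" "t' \<in> set long_seeds"
  proof (cases "length t \<ge> 4")
    case True
    then show ?thesis using that[of "take 4 t"] by (simp add: long_seeds_def set_words)
  next
    case False
    then show ?thesis using assms(2) that[of t] by (auto simp: long_seeds_def)
  qed
  have "take 6 s \<in> set (words 6)"
    using assms(1) by (simp add: set_words)
  then have "unbeaten (partners (take 6 s)) long_seeds = []"
    using unbeaten_long by (simp add: list_all_iff)
  with mem_unbeaten[OF w sublist_take t', of 6] show False by simp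
qed

lemma unexceptional_wins:
  assumes "wins (avoiding {s, t}) [] []"
    and "s \<in> {[0, 0, 0], [0, 1, 0], [1, 0, 1], [1, 1, 1]} \<or> length s \<ge> 4"
    and "t \<in> {[0, 0, 0], [0, 1, 0], [1, 0, 1], [1, 1, 1]} \<or> length t \<ge> 4"
  shows "{s, t} \<in> (\<lambda>(a, b, es). {a, b}) ` set sporadic"
proof -
  have "\<not> 6 \<le> length s"
    using no_win_long assms(1,3) by blast
  moreover have "wins (avoiding {t, s}) [] []"
    using assms(1) by (simp only: insert_commute)
  then have "\<not> 6 \<le> length t"
    using no_win_long assms(2) by blast
  ultimately have "length s < 6" "length t < 6" by simp_all
  then have "s \<in> set short_words" "t \<in> set short_words"
    using assms(2,3) by (auto simp: short_words_def set_words)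
  moreover from this have "t \<in> set (unbeaten (partners s) short_words)"
    using mem_unbeaten[OF assms(1)] by blast
  ultimately obtain a b es where ab: "(a, b, es) \<in> set sporadic" "a = s \<and> b = t \<or> a = t \<and> b = s"
    using unbeaten_short unfolding list_all_iff list_ex_iff by blast
  then have "{s, t} = {a, b}" by blast
  then show ?thesis by (intro rev_image_eqI[OF ab(1)]) simp
qed

text \<open>The classes follow the theorem: words that win alone, words decided by
  \<open>R_sharp\<close>, words decided by \<open>R_sharp_inv\<close>, and words left to the finite
  search.\<close>

lemma short_word_cases:
  fixes s :: "bit list"
  assumes "s \<noteq> []"
  obtains "s \<in> {[0], [1], [0, 1], [1, 0]}"
  | "s \<in> {[0, 0], [0, 0, 1], [1, 0, 0]}"
  | "s \<in> {[1, 1], [0, 1, 1], [1, 1, 0]}"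
  | "s \<in> {[0, 0, 0], [0, 1, 0], [1, 0, 1], [1, 1, 1]} \<or> length s \<ge> 4"
proof (cases "length s \<ge> 4")
  case False
  moreover have "length s \<noteq> 0" using assms by simp
  ultimately have "length s = 1 \<or> length s = 2 \<or> length s = 3" by linarith
  then have "s \<in> set (words 1) \<union> set (words 2) \<union> set (words 3)"
    by (auto simp: set_words)
  then have "s \<in> {[0], [1], [0, 1], [1, 0]} \<or> s \<in> {[0, 0], [0, 0, 1], [1, 0, 0]} \<or>
      s \<in> {[1, 1], [0, 1, 1], [1, 1, 0]} \<or> s \<in> {[0, 0, 0], [0, 1, 0], [1, 0, 1], [1, 1, 1]}"
    by (simp add: words_def numeral_eq_Suc) argo
  then show ?thesis using that by blast
qed (use that in blast)

lemma wins_if_short: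
  assumes "x \<in> S" "x \<in> {[0], [1], [0, 1], [1, 0]}"
  shows "wins (avoiding S) [] []"
proof -
  have "avoiding S \<subseteq> avoiding {[0, 1]} \<or> avoiding S \<subseteq> avoiding {[1, 0]}"
    using assms by (auto intro!: avoiding_mono bexI[of _ x] simp: sublist_Cons_right)
  then show ?thesis
    using wins_mono[OF wins_01] wins_mono wins_01 wins_flip_iff[of "{[0, 1]}"] by auto
qed

theorem theorem8:
  fixes S :: "bit list set" and s\<^sub>1 s\<^sub>2 :: "bit list"
  assumes "S = {s\<^sub>1, s\<^sub>2}" and "s\<^sub>1 \<noteq> s\<^sub>2" and "s\<^sub>1 \<noteq> []" and "s\<^sub>2 \<noteq> []"
  shows "seeker_wins (avoiding S) \<longleftrightarrow>
    S \<inter> {[0], [1], [0, 1], [1, 0]} \<noteq> {} \<or>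
    S \<in> {
       {[0, 0, 0], [1, 0, 1]}, {[0, 0, 0], [1, 0, 1, 1]},
       {[0, 0, 0], [1, 1, 0, 1]}, {[0, 1, 0], [1, 1, 1]},
       {[0, 1, 0], [0, 0, 1, 1]}, {[0, 1, 0], [0, 1, 1, 1]},
       {[0, 1, 0], [1, 1, 0, 0]}, {[0, 1, 0], [1, 1, 1, 0]},
       {[0, 1, 0], [0, 0, 1, 1, 1]}, {[0, 1, 0], [1, 1, 1, 0, 0]},
       {[1, 0, 1], [0, 0, 0, 1]}, {[1, 0, 1], [0, 0, 1, 1]},
       {[1, 0, 1], [1, 0, 0, 0]}, {[1, 0, 1], [1, 1, 0, 0]},
       {[1, 0, 1], [0, 0, 0, 1, 1]}, {[1, 0, 1], [1, 1, 0, 0, 0]},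
       {[1, 1, 1], [0, 0, 1, 0]}, {[1, 1, 1], [0, 1, 0, 0]},
       {[0, 0, 0, 1], [1, 0, 1, 1]}, {[0, 0, 0, 1], [1, 1, 0, 1]},
       {[0, 0, 1, 0], [0, 1, 1, 1]}, {[0, 0, 1, 0], [1, 1, 1, 0]},
       {[0, 0, 1, 1], [0, 1, 0, 1]}, {[0, 1, 0, 0], [0, 1, 1, 1]},
       {[0, 1, 0, 0], [1, 1, 1, 0]}, {[1, 0, 0, 0], [1, 0, 1, 1]},
       {[1, 0, 0, 0], [1, 1, 0, 1]}, {[1, 0, 1, 0], [1, 1, 0, 0]}} \<or>
    (\<exists>u v. S = {u, v} \<and>
      (u \<in> {[0, 0], [0, 0, 1], [1, 0, 0]} \<and> v \<in> R_sharp \<or>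
       u \<in> {[1, 1], [0, 1, 1], [1, 1, 0]} \<and> v \<in> R_sharp_inv))"
proof -
  let ?zero = "{[0, 0], [0, 0, 1], [1, 0, 0]} :: bit list set"
  let ?one = "{[1, 1], [0, 1, 1], [1, 1, 0]} :: bit list set"
  let ?sharp = "\<exists>u v. S = {u, v} \<and> (u \<in> ?zero \<and> v \<in> R_sharp \<or> u \<in> ?one \<and> v \<in> R_sharp_inv)"
  have "wins (avoiding S) [] [] \<longleftrightarrow> S \<inter> {[0], [1], [0, 1], [1, 0]} \<noteq> {} \<or>
      S \<in> (\<lambda>(a, b, es). {a, b}) ` set sporadic \<or> ?sharp"
  proof
    assume w: "wins (avoiding S) [] []"
    \<comment> \<open>A word of either special class decides the pair: if the other word were
      outside the matching set, the Obscurer would win.\<close>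
    have sharp: ?sharp if "S = {u, v}" "u \<in> ?zero \<or> u \<in> ?one" for u v
      using that w not_wins_not_sharp[of u v] not_wins_not_sharp_inv[of u v] by blast
    have S: "S = {s\<^sub>2, s\<^sub>1}" using assms(1) by blast
    show "S \<inter> {[0], [1], [0, 1], [1, 0]} \<noteq> {} \<or>
        S \<in> (\<lambda>(a, b, es). {a, b}) ` set sporadic \<or> ?sharp"
    proof (cases rule: short_word_cases[OF assms(3)])
      case 1
      then show ?thesis using assms(1) by blast
    next
      case 4
      note s1 = this
      show ?thesis
      proof (cases rule: short_word_cases[OF assms(4)])
        case 1
        then show ?thesis using assms(1) by blast
      next
        case 4
        then show ?thesis using unexceptional_wins[OF _ s1] w assms(1) by blast
      qed (use sharp[OF S] in blast)+
    qed (use sharp[OF assms(1)] in blast)+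
  next
    assume "S \<inter> {[0], [1], [0, 1], [1, 0]} \<noteq> {} \<or>
        S \<in> (\<lambda>(a, b, es). {a, b}) ` set sporadic \<or> ?sharp"
    then show "wins (avoiding S) [] []"
    proof (elim disjE)
      assume "S \<in> (\<lambda>(a, b, es). {a, b}) ` set sporadic"
      then show ?thesis using sporadic_wins by fastforce
    next
      assume ?sharp
      then show ?thesis using wins_sharp wins_sharp_inv by blast
    qed (use wins_if_short in blast)
  qed
  then show ?thesis
    unfolding seeker_wins_iff_wins sporadic_def by simp
qed

end
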